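(* Let $\Omega\subset\mathbb{R}^N$ be a bounded domain. Then: (i) The operators $\mathcal{I}_k^-$, with $k<N$, do not satisfy the strong minimum principle in $\Omega$. (ii) The operator $\mathcal{I}_N^-$ satisfies the strong minimum principle in $\Omega$. (iii) The operators $\mathcal{I}_k^+$, with $k\le N$, satisfy the strong minimum principle in $\Omega$.
   Context: Fix $s\in(0,1)$; $k\ge1$ is an integer. An operator $\mathcal{I}$ satisfies the strong minimum principle in $\Omega$ if $$\mathcal{I}u\le 0\text{ in }\Omega,\quad u\ge0\text{ in }\mathbb{R}^N\ \Longrightarrow\ u>0\text{ in }\Omega\ \text{ or }\ u\equiv0\text{ in }\Omega.$$ Here $u\in L^\infty(\mathbb{R}^N)\cap LSC(\Omega)$ (bounded measurable, defined at every point, lower semicontinuous in $\Omega$), and $\mathcal{I}u\le0$ is meant in the viscosity sense below. Set $\delta(u,x,y)=u(x+y)+u(x-y)-2u(x)$, let $C_s=C_{1,s}>0$ be the normalizing constant of the one-dimensional fractional Laplacian, and let $\mathcal{V}_k$ be the family of $k$-dimensional orthonormal sets in $\mathbb{R}^N$. The operators are $\mathcal{I}_k^+u(x)=\sup_{\{\xi_i\}\in\mathcal{V}_k}\sum_{i=1}^k\mathcal{I}_{\xi_i}u(x)$ and $\mathcal{I}_k^-u(x)=\inf_{\{\xi_i\}\in\mathcal{V}_k}\sum_{i=1}^k\mathcal{I}_{\xi_i}u(x)$, where $\mathcal{I}_\xi u(x)=C_s\int_0^{+\infty}\delta(u,x,\tau\xi)\tau^{-1-2s}\,d\tau$. A function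 $u\in L^\infty(\mathbb{R}^N)\cap LSC(\Omega)$ satisfies $\mathcal{I}_k^+u\le0$ in $\Omega$ in the viscosity sense if for every $x_0\in\Omega$, $\rho>0$ and $\varphi\in C^2(B_\rho(x_0))$ such that $x_0$ is a minimum point of $u-\varphi$ in $B_\rho(x_0)$, $$C_s\sup_{\{\xi_i\}\in\mathcal{V}_k}\sum_{i=1}^k\left(\int_0^\rho\frac{\delta(\varphi,x_0,\tau\xi_i)}{\tau^{1+2s}}\,d\tau+\int_\rho^{+\infty}\frac{\delta(u,x_0,\tau\xi_i)}{\tau^{1+2s}}\,d\tau\right)\le 0.$$ For $\mathcal{I}_k^-$ replace $\sup$ by $\inf$. *)

theory Defs
  imports "HOL-Analysis.Analysis"
begin

text \<open>The space \<open>\<real>\<^sup>N\<close> is a type of class \<^class>\<open>euclidean_space\<close>, with \<open>N = DIM('a)\<close>.\<close>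

definition second_diff :: "('a::real_vector \<Rightarrow> real) \<Rightarrow> 'a \<Rightarrow> 'a \<Rightarrow> real" where
  "second_diff u x y = u (x + y) + u (x - y) - 2 * u x"

text \<open>
  The constant \<open>C\<^sub>1\<^sub>,\<^sub>s\<close> for which the one-dimensional operator
  \<open>- C\<^sub>1\<^sub>,\<^sub>s \<integral>\<^sub>0\<^sup>\<infinity> \<delta>(u,x,\<tau>) \<tau>\<^sup>-\<^sup>1\<^sup>-\<^sup>2\<^sup>s d\<tau>\<close> has Fourier symbol \<open>\<bar>\<zeta>\<bar>\<^sup>2\<^sup>s\<close>.
\<close>
definition C_frac :: "real \<Rightarrow> real" where
  "C_frac s = inverse (\<integral>\<zeta>. (1 - cos \<zeta>) / \<bar>\<zeta>\<bar> powr (1 + 2 * s) \<partial>lborel)"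

definition orthonormal_sets :: "nat \<Rightarrow> 'a::euclidean_space set set" where
  "orthonormal_sets k =
     {X. finite X \<and> card X = k \<and> pairwise orthogonal X \<and> (\<forall>\<xi>\<in>X. norm \<xi> = 1)}"

text \<open>
  The integral as positive part minus negative part, with values in \<open>[-\<infinity>, \<infinity>]\<close>.
  A test function that is \<open>C\<^sup>2\<close> on an open ball may tend to \<open>-\<infinity>\<close> at the boundary, and
  the integral of its second difference is then possibly \<open>-\<infinity>\<close>, where the Bochner integral
  would return \<open>0\<close>. The value \<open>+\<infinity>\<close> (hence also \<open>\<infinity> - \<infinity>\<close>) does not occur
  in \<open>visc_le_zero\<close> for bounded \<open>u\<close>: the touching condition bounds
  \<open>second_diff \<phi>\<close> above by \<open>second_diff u\<close>, and \<open>\<phi>\<close> is \<open>C\<^sup>2\<close> near \<open>x\<close>.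
\<close>
definition ext_integral :: "real set \<Rightarrow> (real \<Rightarrow> real) \<Rightarrow> ereal" where
  "ext_integral A f =
     enn2ereal (\<integral>\<^sup>+\<tau>\<in>A. ennreal (f \<tau>) \<partial>lebesgue) - enn2ereal (\<integral>\<^sup>+\<tau>\<in>A. ennreal (- f \<tau>) \<partial>lebesgue)"

text \<open>\<open>I\<^sub>\<xi>\<close> at \<open>x\<close>, with the test function \<open>\<phi>\<close> replacing \<open>u\<close> inside the ball of radius \<open>\<rho>\<close>,
  and without the factor \<open>C\<^sub>s\<close>.\<close>
definition dir_eval ::
    "real \<Rightarrow> ('a::euclidean_space \<Rightarrow> real) \<Rightarrow> ('a \<Rightarrow> real) \<Rightarrow> real \<Rightarrow> 'a \<Rightarrow> 'a \<Rightarrow> ereal" where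
  "dir_eval s u \<phi> \<rho> x \<xi> =
     ext_integral {0<..<\<rho>} (\<lambda>\<tau>. second_diff \<phi> x (\<tau> *\<^sub>R \<xi>) / \<tau> powr (1 + 2 * s)) +
     ext_integral {\<rho>..} (\<lambda>\<tau>. second_diff u x (\<tau> *\<^sub>R \<xi>) / \<tau> powr (1 + 2 * s))"

text \<open>
  An operator enters the viscosity formulation only through its value at \<open>x\<close> on \<open>u\<close> modified
  by \<open>\<phi>\<close> in the ball of radius \<open>\<rho>\<close>; it is represented by the map taking \<open>u\<close>, \<open>\<phi>\<close>, \<open>\<rho>\<close>, \<open>x\<close>
  to that value.
\<close>
type_synonym 'a visc_operator = "('a \<Rightarrow> real) \<Rightarrow> ('a \<Rightarrow> real) \<Rightarrow> real \<Rightarrow> 'a \<Rightarrow> ereal"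

definition I_plus :: "real \<Rightarrow> nat \<Rightarrow> 'a::euclidean_space visc_operator" where
  "I_plus s k u \<phi> \<rho> x =
     ereal (C_frac s) * (SUP X\<in>orthonormal_sets k. \<Sum>\<xi>\<in>X. dir_eval s u \<phi> \<rho> x \<xi>)"

definition I_minus :: "real \<Rightarrow> nat \<Rightarrow> 'a::euclidean_space visc_operator" where
  "I_minus s k u \<phi> \<rho> x =
     ereal (C_frac s) * (INF X\<in>orthonormal_sets k. \<Sum>\<xi>\<in>X. dir_eval s u \<phi> \<rho> x \<xi>)"

definition C2_on :: "'a::euclidean_space set \<Rightarrow> ('a \<Rightarrow> real) \<Rightarrow> bool" where
  "C2_on S \<phi> \<longleftrightarrow>
     (\<exists>(D :: 'a \<Rightarrow> 'a \<Rightarrow>\<^sub>L real) (H :: 'a \<Rightarrow> 'a \<Rightarrow>\<^sub>L 'a \<Rightarrow>\<^sub>L real).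
        (\<forall>x\<in>S. (\<phi> has_derivative blinfun_apply (D x)) (at x)) \<and>
        (\<forall>x\<in>S. (D has_derivative blinfun_apply (H x)) (at x)) \<and>
        continuous_on S H)"

definition lsc_on :: "'a::topological_space set \<Rightarrow> ('a \<Rightarrow> real) \<Rightarrow> bool" where
  "lsc_on S u \<longleftrightarrow> (\<forall>x\<in>S. \<forall>a<u x. \<forall>\<^sub>F y in at x within S. a < u y)"

text \<open>
  The class \<open>L\<^sup>\<infinity>(\<real>\<^sup>N) \<inter> LSC(\<Omega>)\<close> of functions defined at every point. Lebesgue measurability on
  \<open>\<real>\<^sup>N\<close> says nothing about a given line, so the last clause asks that the one-dimensional
  integrands at points of \<open>\<Omega>\<close> be measurable; it holds for every Borel function.
\<close>
definition admissible :: "'a::euclidean_space set \<Rightarrow> ('a \<Rightarrow> real) \<Rightarrow> bool" where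
  "admissible \<Omega> u \<longleftrightarrow>
     bounded (range u) \<and> u \<in> borel_measurable lebesgue \<and> lsc_on \<Omega> u \<and>
     (\<forall>x\<in>\<Omega>. \<forall>\<xi>. norm \<xi> = 1 \<longrightarrow>
        (\<lambda>\<tau>::real. second_diff u x (\<tau> *\<^sub>R \<xi>)) \<in> borel_measurable lebesgue)"

definition visc_le_zero ::
    "'a::euclidean_space visc_operator \<Rightarrow> 'a set \<Rightarrow> ('a \<Rightarrow> real) \<Rightarrow> bool" where
  "visc_le_zero I \<Omega> u \<longleftrightarrow>
     (\<forall>x\<in>\<Omega>. \<forall>\<rho>>0. \<forall>\<phi>. C2_on (ball x \<rho>) \<phi> \<and> (\<forall>y\<in>ball x \<rho>. u x - \<phi> x \<le> u y - \<phi> y)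
        \<longrightarrow> I u \<phi> \<rho> x \<le> 0)"

definition strong_minimum_principle ::
    "'a::euclidean_space visc_operator \<Rightarrow> 'a set \<Rightarrow> bool" where
  "strong_minimum_principle I \<Omega> \<longleftrightarrow>
     (\<forall>u. admissible \<Omega> u \<and> visc_le_zero I \<Omega> u \<and> (\<forall>x. 0 \<le> u x) \<longrightarrow>
        (\<forall>x\<in>\<Omega>. 0 < u x) \<or> (\<forall>x\<in>\<Omega>. u x = 0))"

end

theory Submission
  imports Defs
begin

text \<open>
  For \<open>k < N\<close> the indicator of the complement of a hyperplane meeting \<open>\<Omega>\<close> is a counterexample,
  as it is constant along \<open>N - 1\<close> orthonormal directions.
  In the positive cases the zero function is a test function at every zero \<open>x\<close> of \<open>u\<close>, so that the
  operator is a supremum or infimum of sums of nonnegative line integrals of \<open>u\<close> through \<open>x\<close>. The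
  supremum sees the line through \<open>x\<close> and any given point where \<open>u\<close> is positive. For the infimum,
  \<open>x\<close> is chosen on the boundary of a ball inside \<open>{u > 0}\<close>: some vector of every orthonormal basis
  makes an angle with the inner normal whose cosine is at least \<open>1 / sqrt N\<close> up to sign, so its line
  runs through a fixed smaller concentric ball, where \<open>u\<close> is bounded below, for a fixed length.
\<close>

section \<open>Positivity of the normalizing constant\<close>

lemma one_minus_cos_le: "1 - cos x \<le> x\<^sup>2 / (2::real)"
proof -
  have "\<bar>sin (x/2)\<bar>\<^sup>2 \<le> \<bar>x/2\<bar>\<^sup>2"
    by (intro power_mono abs_sin_x_le_abs_x) auto
  then have "(sin (x/2))\<^sup>2 \<le> (x/2)\<^sup>2" by (simp only: power2_abs)
  moreover have "cos x = 1 - 2 * (sin (x/2))\<^sup>2"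
    using cos_double_sin[of "x/2"] by simp
  ultimately show ?thesis by (simp add: power2_eq_square)
qed

text \<open>Near 0 the integrand is at most \<open>x powr (1 - 2 * s)\<close>, integrable because
  \<open>s < 1\<close>; on \<open>{1..}\<close> it is at most
  \<open>2 * x powr (- 1 - 2 * s)\<close>, integrable because \<open>0 < s\<close>. Without
  integrability the Bochner integral would be 0 and \<open>C_frac s\<close> would collapse to
  \<open>inverse 0 = 0\<close>.\<close>

lemma frac_symbol_integrable:
  fixes s :: real
  assumes "0 < s" "s < 1"
  shows "integrable lborel (\<lambda>\<zeta>::real. (1 - cos \<zeta>) / \<bar>\<zeta>\<bar> powr (1 + 2 * s))"
proof -
  let ?f = "\<lambda>\<zeta>::real. (1 - cos \<zeta>) / \<bar>\<zeta>\<bar> powr (1 + 2 * s)"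
  have [measurable]: "?f \<in> borel_measurable borel" by measurable
  have meas: "set_borel_measurable lebesgue A ?f" if "A \<in> sets borel" for A
  proof -
    have "(\<lambda>x. indicator A x *\<^sub>R ?f x) \<in> borel_measurable borel"
      using that by measurable
    then show ?thesis
      unfolding set_borel_measurable_def by (intro measurable_completion) simp
  qed
  have 1: "set_integrable lebesgue {0<..1} ?f"
  proof (rule set_integrable_bound[OF _ meas])
    show "set_integrable lebesgue {0<..1} (\<lambda>x::real. x powr (1 - 2 * s))"
      using assms by (intro nonnegative_absolutely_integrable_1 integrable_on_powr_from_0') auto
    show "AE x in lebesgue. x \<in> {0<..1} \<longrightarrow> norm (?f x) \<le> norm (x powr (1 - 2 * s))"
    proof (intro AE_I2 impI)
      fix x :: real assume "x \<in> {0<..1}"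
      then have x: "0 < x" by auto
      have "1 - cos x \<le> x\<^sup>2"
        using one_minus_cos_le[of x] zero_le_power2[of x] by linarith
      then have "?f x \<le> x\<^sup>2 / x powr (1 + 2 * s)"
        using x by (simp add: divide_right_mono)
      also have "\<dots> = x powr 2 / x powr (1 + 2 * s)" using x by simp
      also have "\<dots> = x powr (1 - 2 * s)"
        by (simp add: powr_diff[symmetric])
      finally show "norm (?f x) \<le> norm (x powr (1 - 2 * s))" using x by simp
    qed
  qed simp
  have 2: "set_integrable lebesgue {1..} ?f"
  proof (rule set_integrable_bound[OF _ meas])
    have "(\<lambda>x::real. x powr (- 1 - 2 * s)) integrable_on {1..}"
      using has_integral_powr_to_inf[of "- 1 - 2 * s" 1] assms
      unfolding integrable_on_def by auto
    then have "(\<lambda>x::real. x powr (- 1 - 2 * s)) absolutely_integrable_on {1..}"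
      by (intro nonnegative_absolutely_integrable_1) auto
    then show "set_integrable lebesgue {1..} (\<lambda>x::real. 2 * x powr (- 1 - 2 * s))"
      by (rule set_integrable_mult_right)
    show "AE x in lebesgue. x \<in> {1..} \<longrightarrow> norm (?f x) \<le> norm (2 * x powr (- 1 - 2 * s))"
    proof (intro AE_I2 impI)
      fix x :: real assume "x \<in> {1..}"
      then have x: "0 < x" by auto
      have "1 - cos x \<le> 2" using cos_ge_minus_one[of x] by linarith
      then have "?f x \<le> 2 / x powr (1 + 2 * s)"
        using x by (simp add: divide_right_mono)
      also have "\<dots> = 2 * x powr (- (1 + 2 * s))" by (simp only: powr_minus_divide)
      finally show "norm (?f x) \<le> norm (2 * x powr (- 1 - 2 * s))" using x by simp
    qed
  qed simp
  have "set_integrable lebesgue ({0<..1} \<union> {1..}) ?f"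
    using 1 2 by (rule set_integrable_Un) auto
  moreover have "{0<..1} \<union> {1..} = {0::real<..}" by auto
  ultimately have "set_integrable lebesgue {0<..} ?f" by simp
  then have pos: "integrable lborel (\<lambda>x. indicator {0<..} x * ?f x)"
    unfolding set_integrable_def by (simp add: integrable_completion)
  from lborel_integrable_real_affine[OF this, of "-1" 0]
  have neg: "integrable lborel (\<lambda>x. indicator {0<..} (-x) * ?f x)" by simp
  \<comment> \<open>The integrand is even, so the reflected half is integrable too; at 0 both sides
    vanish since \<open>1 - cos 0 = 0\<close>.\<close>
  have "?f = (\<lambda>x. indicator {0<..} x * ?f x + indicator {0<..} (-x) * ?f x)"
    by (auto simp: fun_eq_iff indicator_def)
  then show ?thesis using Bochner_Integration.integrable_add[OF pos neg] by simp
qed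

lemma C_frac_pos:
  assumes "0 < s" "s < 1"
  shows "0 < C_frac s"
proof -
  let ?f = "\<lambda>\<zeta>::real. (1 - cos \<zeta>) / \<bar>\<zeta>\<bar> powr (1 + 2 * s)"
  have nonneg: "0 \<le> ?f x" for x by simp
  have "integral\<^sup>L lborel ?f \<noteq> 0"
  proof
    assume "integral\<^sup>L lborel ?f = 0"
    then have "AE x in lborel. ?f x = 0"
      using integral_nonneg_eq_0_iff_AE[OF frac_symbol_integrable[OF assms]] nonneg by auto
    \<comment> \<open>Any interval of positive length inside (0, pi) would do: there
      \<open>cos\<close> stays strictly below 1.\<close>
    then have "AE x in lborel. x \<notin> {1..2::real}"
    proof (rule AE_mp, intro AE_I2 impI notI)
      fix x :: real assume x: "?f x = 0" "x \<in> {1..2}"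
      then have "cos x = 1" by auto
      moreover have "cos x < cos 0"
        by (rule cos_monotone_0_pi) (use x pi_gt3 in auto)
      ultimately show False by simp
    qed
    then have "emeasure lborel {1..2::real} = 0"
      by (subst (asm) AE_iff_measurable[of "{1..2}"]) auto
    then show False by simp
  qed
  moreover have "0 \<le> integral\<^sup>L lborel ?f" by (simp add: Bochner_Integration.integral_nonneg)
  ultimately have "0 < integral\<^sup>L lborel ?f" by linarith
  then show ?thesis unfolding C_frac_def by simp
qed

section \<open>Sign and size of the line integrals\<close>

lemma ext_integral_nonpos:
  assumes "\<And>\<tau>. \<tau> \<in> A \<Longrightarrow> f \<tau> \<le> 0"
  shows "ext_integral A f \<le> 0"
proof -
  have "(\<integral>\<^sup>+\<tau>\<in>A. ennreal (f \<tau>) \<partial>lebesgue) = (\<integral>\<^sup>+\<tau>. 0 \<partial>(lebesgue :: real measure))"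
    by (intro nn_integral_cong) (use assms in \<open>auto simp: indicator_def ennreal_neg\<close>)
  then show ?thesis unfolding ext_integral_def by (simp add: zero_ennreal.rep_eq)
qed

lemma ext_integral_nonneg_eq:
  assumes "\<And>\<tau>. \<tau> \<in> A \<Longrightarrow> 0 \<le> f \<tau>"
  shows "ext_integral A f = enn2ereal (\<integral>\<^sup>+\<tau>\<in>A. ennreal (f \<tau>) \<partial>lebesgue)"
proof -
  have "(\<integral>\<^sup>+\<tau>\<in>A. ennreal (- f \<tau>) \<partial>lebesgue) = (\<integral>\<^sup>+\<tau>. 0 \<partial>(lebesgue :: real measure))"
    by (intro nn_integral_cong) (use assms in \<open>auto simp: indicator_def ennreal_neg\<close>)
  then show ?thesis unfolding ext_integral_def by (simp add: zero_ennreal.rep_eq)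
qed

text \<open>The constant \<open>m\<close> on \<open>{a..b}\<close>, extended by 0, lies below the
  integrand.\<close>

lemma ext_integral_ge:
  assumes "\<And>\<tau>. \<tau> \<in> A \<Longrightarrow> 0 \<le> f \<tau>" "{a..b} \<subseteq> A" "a \<le> b" "0 \<le> m"
    and "\<And>\<tau>. \<tau> \<in> {a..b} \<Longrightarrow> m \<le> f \<tau>"
  shows "ereal (m * (b - a)) \<le> ext_integral A f"
proof -
  have "ennreal (m * (b - a)) = (\<integral>\<^sup>+\<tau>. ennreal m * indicator {a..b} \<tau> \<partial>lebesgue)"
    using assms by (simp add: nn_integral_cmult_indicator ennreal_mult)
  also have "\<dots> \<le> (\<integral>\<^sup>+\<tau>\<in>A. ennreal (f \<tau>) \<partial>lebesgue)"
    by (intro nn_integral_mono) (use assms in \<open>auto simp: indicator_def ennreal_leI\<close>)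
  finally have "enn2ereal (ennreal (m * (b - a))) \<le> ext_integral A f"
    by (simp only: ext_integral_nonneg_eq[of A f, OF assms(1)] less_eq_ennreal.rep_eq)
  then show ?thesis using assms by (simp add: enn2ereal_ennreal)
qed

text \<open>Adding the touching condition at x + \<tau>\<xi> and x - \<tau>\<xi> bounds the second
  difference of \<phi> by that of \<open>u\<close>, so the inner integral inherits the sign of the
  outer one.\<close>

lemma dir_eval_nonpos:
  assumes "\<And>y. y \<in> ball x \<rho> \<Longrightarrow> u x - \<phi> x \<le> u y - \<phi> y" "0 < \<rho>" "norm \<xi> = 1"
    and "\<And>\<tau>. second_diff u x (\<tau> *\<^sub>R \<xi>) \<le> 0"
  shows "dir_eval s u \<phi> \<rho> x \<xi> \<le> 0"
proof -
  have "second_diff \<phi> x (\<tau> *\<^sub>R \<xi>) \<le> 0" if "\<tau> \<in> {0<..<\<rho>}" for \<tau>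
    using assms(1)[of "x + \<tau> *\<^sub>R \<xi>"] assms(1)[of "x - \<tau> *\<^sub>R \<xi>"] assms(3) assms(4)[of \<tau>] that
    by (auto simp: second_diff_def dist_norm)
  then have "ext_integral {0<..<\<rho>} (\<lambda>\<tau>. second_diff \<phi> x (\<tau> *\<^sub>R \<xi>) / \<tau> powr (1 + 2 * s)) \<le> 0"
    by (intro ext_integral_nonpos divide_nonpos_nonneg) auto
  moreover have "ext_integral {\<rho>..} (\<lambda>\<tau>. second_diff u x (\<tau> *\<^sub>R \<xi>) / \<tau> powr (1 + 2 * s)) \<le> 0"
    by (intro ext_integral_nonpos divide_nonpos_nonneg assms) auto
  ultimately show ?thesis unfolding dir_eval_def using add_mono by fastforce
qed

lemma dir_eval_at_zero:
  assumes "u x = 0"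
  shows "dir_eval s u (\<lambda>_. 0) \<rho> x \<xi> =
    ext_integral {\<rho>..} (\<lambda>\<tau>. (u (x + \<tau> *\<^sub>R \<xi>) + u (x - \<tau> *\<^sub>R \<xi>)) / \<tau> powr (1 + 2 * s))"
  using assms by (simp add: dir_eval_def second_diff_def ext_integral_def)

lemma dir_eval_nonneg:
  assumes "u x = 0" "\<And>y. 0 \<le> u y"
  shows "0 \<le> dir_eval s u (\<lambda>_. 0) \<rho> x \<xi>"
  unfolding dir_eval_at_zero[of u, OF assms(1)]
  by (subst ext_integral_nonneg_eq) (auto intro!: divide_nonneg_nonneg add_nonneg_nonneg assms)

lemma dir_eval_le_sum:
  assumes "u x = 0" "\<And>y. 0 \<le> u y" "X \<in> orthonormal_sets k" "\<xi> \<in> X"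
  shows "dir_eval s u (\<lambda>_. 0) \<rho> x \<xi> \<le> (\<Sum>\<xi>\<in>X. dir_eval s u (\<lambda>_. 0) \<rho> x \<xi>)"
  using sum_mono2[of X "{\<xi>}" "dir_eval s u (\<lambda>_. 0) \<rho> x"]
    dir_eval_nonneg[of u, OF assms(1,2)] assms(3,4)
  by (simp add: orthonormal_sets_def)

text \<open>The bound depends on \<xi> only through the hypothesis on \<open>u\<close>, so it can be
  made uniform over directions. The left endpoint \<open>a\<close> doubles as the radius of the test
  ball, which keeps the kernel away from its singularity.\<close>

lemma dir_eval_ge:
  assumes "u x = 0" "\<And>y. 0 \<le> u y" "0 < a" "a < b" "0 < c" "0 < s"
    and "\<And>\<tau>. \<tau> \<in> {a..b} \<Longrightarrow> c \<le> u (x + \<tau> *\<^sub>R \<xi>) + u (x - \<tau> *\<^sub>R \<xi>)"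
  shows "ereal (c / b powr (1 + 2 * s) * (b - a)) \<le> dir_eval s u (\<lambda>_. 0) a x \<xi>"
  unfolding dir_eval_at_zero[of u, OF assms(1)]
proof (rule ext_integral_ge)
  fix \<tau> assume \<tau>: "\<tau> \<in> {a..b}"
  then have "\<tau> powr (1 + 2 * s) \<le> b powr (1 + 2 * s)" "0 < \<tau> powr (1 + 2 * s)"
    using assms by (auto intro!: powr_mono2)
  then show "c / b powr (1 + 2 * s) \<le> (u (x + \<tau> *\<^sub>R \<xi>) + u (x - \<tau> *\<^sub>R \<xi>)) / \<tau> powr (1 + 2 * s)"
    using assms(5) assms(7)[OF \<tau>] by (intro frac_le) auto
qed (use assms in \<open>auto intro!: divide_nonneg_nonneg add_nonneg_nonneg\<close>)

lemma C2_on_zero: "C2_on S (\<lambda>_. 0)"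
  unfolding C2_on_def
  by (intro exI[of _ "\<lambda>_. 0"] conjI ballI) (auto simp: zero_blinfun.rep_eq)

text \<open>A zero of a nonnegative function is a global minimum, so the zero function touches from
  below in a ball of any radius.\<close>

lemma visc_le_zero_at_zero:
  assumes "visc_le_zero I \<Omega> u" "x \<in> \<Omega>" "u x = 0" "\<And>y. 0 \<le> u y" "0 < \<rho>"
  shows "I u (\<lambda>_. 0) \<rho> x \<le> 0"
proof -
  have "C2_on (ball x \<rho>) (\<lambda>_. 0) \<and> (\<forall>y\<in>ball x \<rho>. u x - 0 \<le> u y - 0)"
    using C2_on_zero assms(3,4) by simp
  then show ?thesis
    using assms(1,2,5) unfolding visc_le_zero_def by blast
qed

section \<open>Consequences of lower semicontinuity\<close>

lemma open_superlevel:
  assumes "open \<Omega>" "lsc_on \<Omega> u"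
  shows "open {x \<in> \<Omega>. a < u x}"
proof (rule iffD2[OF open_subopen], rule ballI)
  fix x assume x: "x \<in> {x \<in> \<Omega>. a < u x}"
  then have "\<forall>\<^sub>F y in at x within \<Omega>. a < u y"
    using assms(2) unfolding lsc_on_def by blast
  then have "\<forall>\<^sub>F y in at x. a < u y"
    using x assms(1) at_within_open[of x \<Omega>] by simp
  then have "\<forall>\<^sub>F y in nhds x. a < u y"
    using x by (simp add: eventually_nhds_conv_at)
  then obtain T where "open T" "x \<in> T" "\<forall>y\<in>T. a < u y"
    unfolding eventually_nhds by blast
  then show "\<exists>T. open T \<and> x \<in> T \<and> T \<subseteq> {x \<in> \<Omega>. a < u x}"
    using x assms by (intro exI[of _ "T \<inter> \<Omega>"]) auto
qed

text \<open>The superlevel sets for the levels \<open>1 / Suc n\<close> form an open cover of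
  \<open>K\<close>; the lowest level of a finite subcover is a lower bound.\<close>

lemma lsc_pos_on_compact:
  fixes u :: "'a::euclidean_space \<Rightarrow> real"
  assumes "open \<Omega>" "lsc_on \<Omega> u" "compact K" "K \<subseteq> \<Omega>" "\<And>x. x \<in> K \<Longrightarrow> 0 < u x"
  obtains c where "0 < c" "\<And>x. x \<in> K \<Longrightarrow> c \<le> u x"
proof -
  let ?G = "\<lambda>n. {x \<in> \<Omega>. 1 / real (Suc n) < u x}"
  have "K \<subseteq> (\<Union>n\<in>UNIV. ?G n)"
  proof
    fix x assume "x \<in> K"
    with assms obtain n where "inverse (real (Suc n)) < u x" "x \<in> \<Omega>"
      by (meson reals_Archimedean subsetD)
    then show "x \<in> (\<Union>n\<in>UNIV. ?G n)" by (auto simp: inverse_eq_divide)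
  qed
  then obtain C where C: "finite C" "K \<subseteq> (\<Union>n\<in>C. ?G n)"
    by (rule compactE_image[OF \<open>compact K\<close> open_superlevel[OF assms(1,2)]])
  show thesis
  \<comment> \<open>Inserting 0 keeps \<open>Max\<close> meaningful when the subcover is
    empty.\<close>
  proof (rule that[of "1 / real (Suc (Max (insert 0 C)))"])
    fix x assume "x \<in> K"
    then obtain n where n: "n \<in> C" "1 / real (Suc n) < u x" using C by blast
    then have "n \<le> Max (insert 0 C)" using C(1) by (intro Max_ge) auto
    then have "1 / real (Suc (Max (insert 0 C))) \<le> 1 / real (Suc n)"
      by (intro divide_left_mono) auto
    then show "1 / real (Suc (Max (insert 0 C))) \<le> u x" using n by linarith
  qed simp
qed

section \<open>Orthonormal sets and bases\<close>

lemma orthonormal_sets_extend: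
  fixes \<xi> :: "'a::euclidean_space"
  assumes "norm \<xi> = 1" "1 \<le> k" "k \<le> DIM('a)"
  obtains X where "X \<in> orthonormal_sets k" "\<xi> \<in> X"
proof -
  obtain S where S: "\<xi> \<in> S" "pairwise orthogonal S" "\<And>x. x \<in> S \<Longrightarrow> norm x = 1"
    "card S = DIM('a)"
    using vector_in_orthonormal_basis[OF assms(1)] by metis
  have fin: "finite S" using S(4) by (intro card_ge_0_finite) simp
  have "k - 1 \<le> card (S - {\<xi>})" using S fin assms by simp
  then obtain T where T: "T \<subseteq> S - {\<xi>}" "card T = k - 1" "finite T"
    by (rule obtain_subset_with_card_n)
  have "insert \<xi> T \<subseteq> S" using T S by blast
  moreover have "card (insert \<xi> T) = k"
    using T assms by (subst card_insert_disjoint) auto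
  ultimately have "insert \<xi> T \<in> orthonormal_sets k"
    using T S unfolding orthonormal_sets_def by (auto intro: pairwise_subset)
  then show thesis by (intro that) auto
qed

text \<open>By Parseval the squared components of \<open>v\<close> add up to its squared norm, so N
  of them cannot all be smaller than the N-th part of it. This is where a full basis is essential:
  fewer vectors could all be orthogonal to \<open>v\<close>.\<close>

lemma orthonormal_basis_large_component:
  fixes v :: "'a::euclidean_space"
  assumes "X \<in> orthonormal_sets DIM('a)"
  obtains \<xi> where "\<xi> \<in> X" "norm v / sqrt DIM('a) \<le> \<bar>v \<bullet> \<xi>\<bar>"
proof (rule ccontr)
  assume "\<not> thesis"
  then have less: "\<bar>v \<bullet> \<xi>\<bar> < norm v / sqrt DIM('a)" if "\<xi> \<in> X" for \<xi>
    using that \<open>\<And>\<xi>. \<lbrakk>\<xi> \<in> X; norm v / sqrt DIM('a) \<le> \<bar>v \<bullet> \<xi>\<bar>\<rbrakk> \<Longrightarrow> thesis\<close> by fastforce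
  have X: "finite X" "card X = DIM('a)" "pairwise orthogonal X" "\<forall>\<xi>\<in>X. norm \<xi> = 1"
    using assms unfolding orthonormal_sets_def by auto
  then have "0 \<notin> X" by auto
  then have "independent X" using X pairwise_orthogonal_independent by blast
  then have span: "span X = UNIV" using X
    by (metis card_eq_dim dim_UNIV span_UNIV dim_eq_full dim_eq_card_independent)
  have "v = (\<Sum>\<xi>\<in>X. (v \<bullet> \<xi>) *\<^sub>R \<xi>)"
    using orthonormal_basis_expand[of X v] X span by auto
  then have "v \<bullet> v = v \<bullet> (\<Sum>\<xi>\<in>X. (v \<bullet> \<xi>) *\<^sub>R \<xi>)" by simp
  also have "\<dots> = (\<Sum>\<xi>\<in>X. (v \<bullet> \<xi>)\<^sup>2)"
    by (simp add: inner_sum_right power2_eq_square)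
  also have "\<dots> < (\<Sum>\<xi>\<in>X. (norm v / sqrt DIM('a))\<^sup>2)"
  proof (rule sum_strict_mono)
    fix \<xi> assume "\<xi> \<in> X"
    then show "(v \<bullet> \<xi>)\<^sup>2 < (norm v / sqrt DIM('a))\<^sup>2"
      using power_strict_mono[OF less[of \<xi>], of 2] by simp
  qed (use X in auto)
  also have "\<dots> = v \<bullet> v" using X by (simp add: power_divide power2_norm_eq_inner)
  finally show False by simp
qed

section \<open>The strong minimum principle for the supremum operators\<close>

lemma I_plus_strong_minimum_principle:
  fixes \<Omega> :: "'a::euclidean_space set"
  assumes s: "0 < s" "s < 1" and \<Omega>: "open \<Omega>" and k: "1 \<le> k" "k \<le> DIM('a)"
  shows "strong_minimum_principle (I_plus s k :: 'a visc_operator) \<Omega>"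
  unfolding strong_minimum_principle_def
proof (intro allI impI, elim conjE, rule ccontr)
  fix u :: "'a \<Rightarrow> real"
  assume adm: "admissible \<Omega> u" and visc: "visc_le_zero (I_plus s k) \<Omega> u"
    and nonneg': "\<forall>x. 0 \<le> u x" and "\<not> ((\<forall>x\<in>\<Omega>. 0 < u x) \<or> (\<forall>x\<in>\<Omega>. u x = 0))"
  then obtain x y where x: "x \<in> \<Omega>" "u x = 0" and y: "y \<in> \<Omega>" "0 < u y"
    by (metis order_le_less)
  have nonneg: "0 \<le> u z" for z using nonneg' by simp
  define T where "T = dist x y"
  define \<xi> where "\<xi> = (y - x) /\<^sub>R T"
  have T: "0 < T" using x y unfolding T_def by auto
  have \<xi>: "norm \<xi> = 1" "x + T *\<^sub>R \<xi> = y"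
    using T unfolding \<xi>_def T_def by (auto simp: dist_norm norm_minus_commute)
  have "open {z \<in> \<Omega>. u y / 2 < u z}"
    using adm \<Omega> by (intro open_superlevel) (auto simp: admissible_def)
  moreover have "y \<in> {z \<in> \<Omega>. u y / 2 < u z}" using y by auto
  ultimately obtain e where e: "0 < e" "ball y e \<subseteq> {z \<in> \<Omega>. u y / 2 < u z}"
    by (meson open_contains_ball)
  \<comment> \<open>For \<tau> between \<open>T\<close> and \<open>b\<close> the point x +
    \<tau>\<xi> moves at most \<open>e / 2\<close> beyond \<open>y\<close>, hence stays in
    \<open>ball y e\<close>.\<close>
  define b where "b = T + e / 2"
  have b: "T < b" using e by (simp add: b_def)
  have low: "u y / 2 \<le> u (x + \<tau> *\<^sub>R \<xi>) + u (x - \<tau> *\<^sub>R \<xi>)" if "\<tau> \<in> {T..b}" for \<tau>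
  proof -
    have "x + \<tau> *\<^sub>R \<xi> - y = (\<tau> - T) *\<^sub>R \<xi>" using \<xi>(2) by (simp add: algebra_simps)
    then have "dist (x + \<tau> *\<^sub>R \<xi>) y < e"
      using that \<xi>(1) e(1) by (simp add: dist_norm b_def)
    then have "x + \<tau> *\<^sub>R \<xi> \<in> ball y e" by (simp add: dist_commute)
    then show ?thesis using e(2) nonneg[of "x - \<tau> *\<^sub>R \<xi>"] by auto
  qed
  define d where "d = u y / 2 / b powr (1 + 2 * s) * (b - T)"
  have d: "0 < d" using y b T by (simp add: d_def)
  obtain X where X: "X \<in> orthonormal_sets k" "\<xi> \<in> X"
    using orthonormal_sets_extend[OF \<xi>(1) k] .
  have "ereal d \<le> dir_eval s u (\<lambda>_. 0) T x \<xi>"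
    unfolding d_def using x nonneg T b y s low by (intro dir_eval_ge) auto
  also have "\<dots> \<le> (\<Sum>\<xi>\<in>X. dir_eval s u (\<lambda>_. 0) T x \<xi>)"
    using X x nonneg by (intro dir_eval_le_sum) auto
  also have "\<dots> \<le> (SUP X\<in>orthonormal_sets k. \<Sum>\<xi>\<in>X. dir_eval s u (\<lambda>_. 0) T x \<xi>)"
    using X(1) by (rule SUP_upper)
  finally have "0 < (SUP X\<in>orthonormal_sets k. \<Sum>\<xi>\<in>X. dir_eval s u (\<lambda>_. 0) T x \<xi>)"
    using d by (metis ereal_less(2) order_less_le_trans)
  then have "0 < I_plus s k u (\<lambda>_. 0) T x"
    unfolding I_plus_def using C_frac_pos[OF s] by (simp add: ereal_zero_less_0_iff)
  moreover have "I_plus s k u (\<lambda>_. 0) T x \<le> 0"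
    using visc_le_zero_at_zero[OF visc] x nonneg T by blast
  ultimately show False by simp
qed

section \<open>The strong minimum principle for the infimum over full bases\<close>

text \<open>Connectedness yields a zero with positive points arbitrarily near. A ball around such a
  positive point is enlarged until it first meets a zero.\<close>

lemma lsc_touching_ball:
  fixes u :: "'a::euclidean_space \<Rightarrow> real"
  assumes \<Omega>: "open \<Omega>" "connected \<Omega>" and lsc: "lsc_on \<Omega> u" and nonneg: "\<And>x. 0 \<le> u x"
    and p: "p \<in> \<Omega>" "u p = 0" and q: "q \<in> \<Omega>" "0 < u q"
  obtains x y where "x \<in> \<Omega>" "u x = 0" "x \<noteq> y" "ball y (dist x y) \<subseteq> {z \<in> \<Omega>. 0 < u z}"
proof -
  let ?P = "{z \<in> \<Omega>. 0 < u z}" and ?Z = "{z \<in> \<Omega>. u z = 0}"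
  have oP: "open ?P" using open_superlevel[OF \<Omega>(1) lsc] .
  have un: "?P \<union> ?Z = \<Omega>" using nonneg by (auto simp: less_le)
  have "\<not> open ?Z"
  proof
    assume "open ?Z"
    moreover have "?P \<inter> ?Z \<inter> \<Omega> = {}" by auto
    ultimately have "?P \<inter> \<Omega> = {} \<or> ?Z \<inter> \<Omega> = {}"
      using connectedD[OF \<Omega>(2) oP, of ?Z] un by auto
    then show False using p q by auto
  qed
  then obtain x0 where x0: "x0 \<in> ?Z" and nb: "\<And>e. 0 < e \<Longrightarrow> \<not> ball x0 e \<subseteq> ?Z"
    unfolding open_contains_ball by blast
  obtain r where r: "0 < r" "cball x0 r \<subseteq> \<Omega>"
    using \<Omega>(1) x0 by (metis (no_types, lifting) mem_Collect_eq open_contains_cball)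
  obtain y where y: "dist x0 y < r / 2" "y \<notin> ?Z"
    \<comment> \<open>With \<open>y\<close> within \<open>r / 2\<close> of \<open>x0\<close>, the
      ball around \<open>y\<close> reaching to its nearest zero has radius below
      \<open>r / 2\<close> and stays in \<open>cball x0 r\<close>.\<close>
    using nb[of "r / 2"] r(1) unfolding subset_iff mem_ball by auto
  have yP: "y \<in> ?P" using y r un by (auto simp: subset_iff)
  \<comment> \<open>These are the zeros of \<open>u\<close> in the closed ball; since
    \<open>?P\<close> is open they form a compact set, so a nearest one to \<open>y\<close>
    exists.\<close>
  define K where "K = cball x0 r - ?P"
  have "compact K" unfolding K_def using oP by (intro compact_diff) auto
  moreover have "x0 \<in> K" using x0 r by (auto simp: K_def)
  ultimately obtain x where x: "x \<in> K" "\<And>z. z \<in> K \<Longrightarrow> dist y x \<le> dist y z"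
    using distance_attains_inf[of K y] compact_imp_closed by blast
  have xy: "dist y x \<le> dist x0 y" using x(2)[OF \<open>x0 \<in> K\<close>] by (simp add: dist_commute)
  have xZ: "x \<in> ?Z" using x(1) r(2) un unfolding K_def by blast
  have "ball y (dist x y) \<subseteq> ?P"
  proof
    fix z assume z: "z \<in> ball y (dist x y)"
    then have "dist x0 z \<le> r"
      using dist_triangle[of x0 z y] xy y by (simp add: dist_commute)
    moreover have "z \<notin> K" using x(2)[of z] z by (auto simp: dist_commute)
    ultimately show "z \<in> ?P" by (auto simp: K_def)
  qed
  then show thesis using xZ yP by (intro that[of x y]) auto
qed

text \<open>Positivity for each basis separately would allow the infimum to be 0; the point is a
  bound \<open>d\<close> chosen before the basis \<open>X\<close>.\<close>

lemma I_minus_DIM_strong_minimum_principle: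
  fixes \<Omega> :: "'a::euclidean_space set"
  assumes s: "0 < s" "s < 1" and \<Omega>: "open \<Omega>" "connected \<Omega>"
  shows "strong_minimum_principle (I_minus s DIM('a) :: 'a visc_operator) \<Omega>"
  unfolding strong_minimum_principle_def
proof (intro allI impI, elim conjE, rule ccontr)
  fix u :: "'a \<Rightarrow> real"
  assume adm: "admissible \<Omega> u" and visc: "visc_le_zero (I_minus s DIM('a)) \<Omega> u"
    and nonneg': "\<forall>x. 0 \<le> u x" and "\<not> ((\<forall>x\<in>\<Omega>. 0 < u x) \<or> (\<forall>x\<in>\<Omega>. u x = 0))"
  then obtain p q where p: "p \<in> \<Omega>" "u p = 0" and q: "q \<in> \<Omega>" "0 < u q"
    by (metis order_le_less)
  have nonneg: "0 \<le> u z" for z using nonneg' by simp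
  have lsc: "lsc_on \<Omega> u" using adm by (simp add: admissible_def)
  obtain x y where x: "x \<in> \<Omega>" "u x = 0" "x \<noteq> y"
    and ball: "ball y (dist x y) \<subseteq> {z \<in> \<Omega>. 0 < u z}"
    using lsc_touching_ball[OF \<Omega> lsc nonneg p q] .
  define R where "R = norm (y - x)"
  \<comment> \<open>Half of the component of \<open>y - x\<close> guaranteed along some vector of
    any orthonormal basis.\<close>
  define a where "a = R / (2 * sqrt DIM('a))"
  have R: "0 < R" "R = dist x y" using x by (auto simp: R_def dist_norm norm_minus_commute)
  have a: "0 < a" using R by (simp add: a_def)
  \<comment> \<open>The distance from \<open>y\<close> not exceeded by the points of the chosen line
    at parameters between \<open>a\<close> and \<open>2 * a\<close>. It is strictly below
    \<open>R\<close>, which matters because \<open>u\<close> need not be bounded away from 0 near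
    \<open>x\<close>.\<close>
  define r where "r = sqrt (R\<^sup>2 - 2 * a\<^sup>2)"
  have "r < sqrt (R\<^sup>2)" unfolding r_def using a by (intro real_sqrt_less_mono) simp
  then have "r < R" using R by simp
  then have sub: "cball y r \<subseteq> {z \<in> \<Omega>. 0 < u z}" using ball R(2)
    by (intro order_trans[OF _ ball]) auto
  then obtain c where c: "0 < c" "\<And>z. z \<in> cball y r \<Longrightarrow> c \<le> u z"
    using lsc_pos_on_compact[OF \<Omega>(1) lsc compact_cball, of y r] by blast
  define d where "d = c / (2 * a) powr (1 + 2 * s) * (2 * a - a)"
  have d: "0 < d" using c a by (simp add: d_def)
  have "ereal d \<le> (\<Sum>\<xi>\<in>X. dir_eval s u (\<lambda>_. 0) a x \<xi>)"
    if X: "X \<in> orthonormal_sets DIM('a)" for X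
  proof -
    obtain \<xi> where \<xi>: "\<xi> \<in> X" "R / sqrt DIM('a) \<le> \<bar>(y - x) \<bullet> \<xi>\<bar>"
      using orthonormal_basis_large_component[OF X, of "y - x"] unfolding R_def .
    have n1: "norm \<xi> = 1" using X \<xi> by (auto simp: orthonormal_sets_def)
    define t where "t = (y - x) \<bullet> \<xi>"
    have t: "2 * a \<le> \<bar>t\<bar>" using \<xi>(2) by (simp add: a_def t_def)
    \<comment> \<open>The last condition says that \<sigma> has the sign of \<open>t\<close>, so
      that the line is followed towards \<open>y\<close>.\<close>
    have inside: "c \<le> u (x + \<sigma> *\<^sub>R \<xi>)" if "a \<le> \<bar>\<sigma>\<bar>" "\<bar>\<sigma>\<bar> \<le> 2 * a" "\<sigma> * t = \<bar>\<sigma>\<bar> * \<bar>t\<bar>" for \<sigma>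
    proof -
      have "(norm (y - (x + \<sigma> *\<^sub>R \<xi>)))\<^sup>2 = R\<^sup>2 - 2 * (\<sigma> * t) + \<sigma>\<^sup>2"
      proof -
        have "y - (x + \<sigma> *\<^sub>R \<xi>) = (y - x) - \<sigma> *\<^sub>R \<xi>" by simp
        moreover have "\<xi> \<bullet> \<xi> = 1" using n1 by (simp add: norm_eq_1)
        ultimately show ?thesis
          unfolding R_def t_def power2_norm_eq_inner
          by (simp add: inner_diff_left inner_diff_right inner_commute power2_eq_square algebra_simps)
      qed
      also have "\<dots> = R\<^sup>2 - \<bar>\<sigma>\<bar> * (2 * \<bar>t\<bar> - \<bar>\<sigma>\<bar>)"
        using that(3) by (simp add: algebra_simps power2_eq_square)
      \<comment> \<open>Here \<open>2 * \<bar>t\<bar> - \<bar>\<sigma>\<bar>\<close> is at least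
        \<open>4 * a - 2 * a\<close>.\<close>
      also have "\<dots> \<le> R\<^sup>2 - a * (2 * a)"
        using that t a by (intro diff_left_mono mult_mono) auto
      finally have "(norm (y - (x + \<sigma> *\<^sub>R \<xi>)))\<^sup>2 \<le> R\<^sup>2 - 2 * a\<^sup>2"
        by (simp add: power2_eq_square)
      then have "dist y (x + \<sigma> *\<^sub>R \<xi>) \<le> r"
        unfolding r_def dist_norm by (rule real_le_rsqrt)
      then show ?thesis using c(2) by simp
    qed
    have low: "c \<le> u (x + \<tau> *\<^sub>R \<xi>) + u (x - \<tau> *\<^sub>R \<xi>)" if "\<tau> \<in> {a..2 * a}" for \<tau>
    proof (cases "0 \<le> t")
      case True
      then show ?thesis using inside[of \<tau>] that a nonneg[of "x - \<tau> *\<^sub>R \<xi>"] by simp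
    next
      case False
      then show ?thesis using inside[of "- \<tau>"] that a nonneg[of "x + \<tau> *\<^sub>R \<xi>"] by simp
    qed
    have "ereal d \<le> dir_eval s u (\<lambda>_. 0) a x \<xi>"
      unfolding d_def using x nonneg a c s low by (intro dir_eval_ge) auto
    also have "\<dots> \<le> (\<Sum>\<xi>\<in>X. dir_eval s u (\<lambda>_. 0) a x \<xi>)"
      using \<xi>(1) X x nonneg by (intro dir_eval_le_sum) auto
    finally show ?thesis .
  qed
  then have "ereal d \<le> (INF X\<in>orthonormal_sets DIM('a). \<Sum>\<xi>\<in>X. dir_eval s u (\<lambda>_. 0) a x \<xi>)"
    by (intro INF_greatest)
  then have "0 < (INF X\<in>orthonormal_sets DIM('a). \<Sum>\<xi>\<in>X. dir_eval s u (\<lambda>_. 0) a x \<xi>)"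
    using d by (metis ereal_less(2) order_less_le_trans)
  then have "0 < I_minus s DIM('a) u (\<lambda>_. 0) a x"
    unfolding I_minus_def using C_frac_pos[OF s] by (simp add: ereal_zero_less_0_iff)
  moreover have "I_minus s DIM('a) u (\<lambda>_. 0) a x \<le> 0"
    using visc_le_zero_at_zero[OF visc] x nonneg a by blast
  ultimately show False by simp
qed

section \<open>The counterexample for fewer than N directions\<close>

text \<open>A single orthonormal set that works at every point already bounds the infimum from
  above.\<close>

lemma visc_le_zero_I_minusI:
  assumes C: "0 \<le> C_frac s" and X: "X \<in> orthonormal_sets k"
    and sd: "\<And>x \<xi> \<tau>. x \<in> \<Omega> \<Longrightarrow> \<xi> \<in> X \<Longrightarrow> second_diff u x (\<tau> *\<^sub>R \<xi>) \<le> 0"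
  shows "visc_le_zero (I_minus s k) \<Omega> u"
  unfolding visc_le_zero_def
proof (intro ballI allI impI, elim conjE)
  fix x \<rho> and \<phi> :: "'a \<Rightarrow> real"
  assume x: "x \<in> \<Omega>" "0 < \<rho>" "\<forall>y\<in>ball x \<rho>. u x - \<phi> x \<le> u y - \<phi> y"
  have "(INF X\<in>orthonormal_sets k. \<Sum>\<xi>\<in>X. dir_eval s u \<phi> \<rho> x \<xi>)
      \<le> (\<Sum>\<xi>\<in>X. dir_eval s u \<phi> \<rho> x \<xi>)"
    using X by (rule INF_lower)
  also have "\<dots> \<le> 0"
    using X x sd by (intro sum_nonpos dir_eval_nonpos) (auto simp: orthonormal_sets_def)
  finally show "I_minus s k u \<phi> \<rho> x \<le> 0"
    unfolding I_minus_def using C by (simp add: ereal_mult_le_0_iff)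
qed

lemma I_minus_not_strong_minimum_principle:
  fixes \<Omega> :: "'a::euclidean_space set"
  assumes s: "0 < s" "s < 1" and \<Omega>: "open \<Omega>" "\<Omega> \<noteq> {}" and k: "k < DIM('a)"
  shows "\<not> strong_minimum_principle (I_minus s k :: 'a visc_operator) \<Omega>"
proof
  assume smp: "strong_minimum_principle (I_minus s k :: 'a visc_operator) \<Omega>"
  obtain z where z: "z \<in> \<Omega>" using \<Omega> by blast
  obtain e :: 'a where e: "e \<in> Basis" using nonempty_Basis by blast
  define S where "S = {x. x \<bullet> e \<noteq> z \<bullet> e}"
  \<comment> \<open>Since \<open>S\<close> is open, its indicator is lower semicontinuous; it
    vanishes exactly on the hyperplane through \<open>z\<close> normal to \<open>e\<close>.\<close>
  define u :: "'a \<Rightarrow> real" where "u = indicator S"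
  have oS: "open S" unfolding S_def by (intro open_Collect_neq continuous_intros)
  have ub: "u \<in> borel_measurable borel" unfolding u_def using oS by simp
  have u_ge: "0 \<le> u x" for x by (auto simp: u_def indicator_def)
  \<comment> \<open>Because k < N, enough basis vectors remain after removing the normal
    \<open>e\<close>.\<close>
  have "k \<le> card (Basis - {e})" using k e by simp
  then obtain X where X: "X \<subseteq> Basis - {e}" "card X = k" "finite X"
    by (rule obtain_subset_with_card_n)
  have Xo: "X \<in> orthonormal_sets k" unfolding orthonormal_sets_def
    using X by (auto simp: pairwise_def orthogonal_def inner_Basis subset_iff)
  have "second_diff u x (\<tau> *\<^sub>R \<xi>) \<le> 0" if "\<xi> \<in> X" for x \<xi> \<tau>
  proof -
    have "\<xi> \<bullet> e = 0" using that X e by (auto simp: inner_Basis subset_iff)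
    then have "u (x + \<tau> *\<^sub>R \<xi>) = u x" "u (x - \<tau> *\<^sub>R \<xi>) = u x"
      by (simp_all add: u_def S_def indicator_def inner_simps)
    then show ?thesis by (simp add: second_diff_def)
  qed
  then have visc: "visc_le_zero (I_minus s k) \<Omega> u"
    using Xo C_frac_pos[OF s] by (intro visc_le_zero_I_minusI[of s X]) auto
  have adm: "admissible \<Omega> u"
    unfolding admissible_def
  proof (intro conjI ballI allI impI)
    show "bounded (range u)"
      unfolding bounded_iff by (intro exI[of _ 1]) (auto simp: u_def indicator_def)
    show "u \<in> borel_measurable lebesgue" using ub by (simp add: measurable_completion)
    show "lsc_on \<Omega> u"
      unfolding lsc_on_def
    proof (intro ballI allI impI)
      fix x a assume a: "a < u x"
      show "\<forall>\<^sub>F y in at x within \<Omega>. a < u y"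
      proof (cases "x \<in> S")
        case True
        then have "\<forall>\<^sub>F y in at x within \<Omega>. y \<in> S" using oS by (auto simp: eventually_at_topological)
        then show ?thesis by eventually_elim (use a True in \<open>simp add: u_def\<close>)
      next
        case False
        then have "a < 0" using a by (simp add: u_def)
        then show ?thesis using u_ge by (intro always_eventually allI) (meson less_le_trans)
      qed
    qed
    fix x \<xi> :: 'a
    \<comment> \<open>Borel measurability of \<open>u\<close> is used because it passes to
      restrictions to lines.\<close>
    have "(\<lambda>\<tau>::real. second_diff u x (\<tau> *\<^sub>R \<xi>)) \<in> borel_measurable borel"
      unfolding second_diff_def using ub by measurable
    then show "(\<lambda>\<tau>::real. second_diff u x (\<tau> *\<^sub>R \<xi>)) \<in> borel_measurable lebesgue"
      by (simp add: measurable_completion)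
  qed
  obtain r where r: "0 < r" "cball z r \<subseteq> \<Omega>"
    using \<Omega>(1) z by (meson open_contains_cball)
  \<comment> \<open>A step along the normal leaves the hyperplane without leaving \<Omega>, so
    \<open>u\<close> takes both values 0 and 1 there.\<close>
  have "z + r *\<^sub>R e \<in> \<Omega>" using r e by (intro subsetD[OF r(2)]) (simp add: dist_norm)
  moreover have "u (z + r *\<^sub>R e) = 1"
    using r e by (simp add: u_def S_def inner_simps)
  moreover have "u z = 0" by (simp add: u_def S_def)
  ultimately show False
    using smp adm visc u_ge z unfolding strong_minimum_principle_def by fastforce
qed

theorem theorem4p3:
  fixes s :: real and \<Omega> :: "'a::euclidean_space set"
  assumes "0 < s" and "s < 1"
    and "open \<Omega>" and "connected \<Omega>" and "\<Omega> \<noteq> {}" and "bounded \<Omega>"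
  shows "(\<forall>k. 1 \<le> k \<and> k < DIM('a) \<longrightarrow>
            \<not> strong_minimum_principle (I_minus s k :: 'a visc_operator) \<Omega>) \<and>
         strong_minimum_principle (I_minus s DIM('a) :: 'a visc_operator) \<Omega> \<and>
         (\<forall>k. 1 \<le> k \<and> k \<le> DIM('a) \<longrightarrow>
            strong_minimum_principle (I_plus s k :: 'a visc_operator) \<Omega>)"
  using assms by (intro conjI allI impI I_minus_not_strong_minimum_principle
      I_minus_DIM_strong_minimum_principle I_plus_strong_minimum_principle) auto

end
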